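(* The infinite ladder graph $P_2 \square P_\infty$ satisfies $\mathrm{RED{:}IC}\%(P_2 \square P_\infty) = \tfrac{2}{3}$.
   Context: $P_\infty$ is the two-way infinite path (vertices indexed by $\mathbb{Z}$), $P_2$ the path on two vertices, and $\square$ the Cartesian product of graphs; so $P_2 \square P_\infty$ has vertices $x_i, y_i$ ($i \in \mathbb{Z}$) with edges $x_ix_{i+1}$, $y_iy_{i+1}$, $x_iy_i$. $N[v]$ denotes the closed neighborhood of $v$ and $\Delta$ symmetric difference. A set $S \subseteq V(G)$ is a redundant identifying code (RED:IC) if every vertex $v$ satisfies $|N[v] \cap S| \ge 2$ and every pair of distinct vertices $u,v$ satisfies $|(N[u]\cap S)\,\Delta\,(N[v]\cap S)| \ge 2$. The density of $S$ in an infinite graph is $\limsup_{r\to\infty} |S \cap B_r(v_0)|/|B_r(v_0)|$ for a fixed vertex $v_0$, where $B_r(v_0)$ is the set of vertices within distance $r$ of $v_0$; $\mathrm{RED{:}IC}\%(G)$ is the minimum (infimum) density of a RED:IC of $G$. *)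

theory Defs
  imports "HOL-Analysis.Analysis"
begin

text \<open>Possibly infinite simple graphs: a vertex set with a symmetric irreflexive adjacency relation.\<close>

record 'a ugraph =
  verts :: "'a set"
  adj :: "'a \<Rightarrow> 'a \<Rightarrow> bool"

definition simple_graph :: "'a ugraph \<Rightarrow> bool" where
  "simple_graph G \<longleftrightarrow>
     (\<forall>u v. adj G u v \<longrightarrow> u \<in> verts G \<and> v \<in> verts G \<and> u \<noteq> v \<and> adj G v u)"

definition path_graph :: "nat \<Rightarrow> nat ugraph" where
  "path_graph n = \<lparr>verts = {..<n}, adj = (\<lambda>i j. i < n \<and> j < n \<and> (j = i + 1 \<or> i = j + 1))\<rparr>"

definition inf_path_graph :: "int ugraph" where
  "inf_path_graph = \<lparr>verts = UNIV, adj = (\<lambda>i j. j = i + 1 \<or> i = j + 1)\<rparr>"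

definition cart_prod :: "'a ugraph \<Rightarrow> 'b ugraph \<Rightarrow> ('a \<times> 'b) ugraph" (infixr "\<box>" 75) where
  "G \<box> H =
     \<lparr>verts = verts G \<times> verts H,
      adj = (\<lambda>(a, b) (c, d).
        a = c \<and> a \<in> verts G \<and> adj H b d \<or> b = d \<and> b \<in> verts H \<and> adj G a c)\<rparr>"

lemma simple_graph_path: "simple_graph (path_graph n)"
  by (auto simp: simple_graph_def path_graph_def)

lemma simple_graph_inf_path: "simple_graph inf_path_graph"
  by (auto simp: simple_graph_def inf_path_graph_def)

lemma simple_graph_cart_prod:
  "simple_graph G \<Longrightarrow> simple_graph H \<Longrightarrow> simple_graph (G \<box> H)"
  by (auto simp: simple_graph_def cart_prod_def)

definition closed_nbhd :: "'a ugraph \<Rightarrow> 'a \<Rightarrow> 'a set" where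
  "closed_nbhd G v = insert v {u \<in> verts G. adj G v u}"

text \<open>The distance is the least length of a walk, and \<open>\<infinity>\<close> if there is none.\<close>

definition gdist :: "'a ugraph \<Rightarrow> 'a \<Rightarrow> 'a \<Rightarrow> enat" where
  "gdist G u v = (INF n \<in> {n. (u, v) \<in> {(x, y). adj G x y} ^^ n}. enat n)"

definition gball :: "'a ugraph \<Rightarrow> 'a \<Rightarrow> nat \<Rightarrow> 'a set" where
  "gball G v r = {u \<in> verts G. gdist G v u \<le> enat r}"

text \<open>The cardinalities below are meaningful for locally finite graphs, where closed
  neighborhoods and balls are finite.\<close>

definition RED_IC :: "'a ugraph \<Rightarrow> 'a set \<Rightarrow> bool" where
  "RED_IC G S \<longleftrightarrow> S \<subseteq> verts G \<and>
     (\<forall>v \<in> verts G. card (closed_nbhd G v \<inter> S) \<ge> 2) \<and>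
     (\<forall>u \<in> verts G. \<forall>v \<in> verts G. u \<noteq> v \<longrightarrow>
        card (sym_diff (closed_nbhd G u \<inter> S) (closed_nbhd G v \<inter> S)) \<ge> 2)"

definition code_density :: "'a ugraph \<Rightarrow> 'a \<Rightarrow> 'a set \<Rightarrow> ereal" where
  "code_density G v0 S =
     limsup (\<lambda>r. ereal (real (card (S \<inter> gball G v0 r)) / real (card (gball G v0 r))))"

definition RED_IC_density :: "'a ugraph \<Rightarrow> 'a \<Rightarrow> ereal" where
  "RED_IC_density G v0 = (INF S \<in> {S. RED_IC G S}. code_density G v0 S)"

end

theory Submission
  imports Defs "HOL-Real_Asymp.Real_Asymp"
begin

text \<open>
  Write \<open>c\<^sub>j\<close> for the number of code vertices in column \<open>j\<close>. In a RED:IC, a column with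
  \<open>c\<^sub>j = 0\<close> forces \<open>c\<close> to be \<open>2\<close> on the two columns on either side of it, and three consecutive
  columns cannot all have \<open>c = 1\<close>. These two facts suffice for a potential argument: a bounded
  function \<open>\<phi>\<close> of \<open>(c\<^bsub>j-1\<^esub>, c\<^sub>j)\<close> satisfies \<open>\<phi>\<^bsub>j+1\<^esub> - \<phi>\<^sub>j \<le> 3 c\<^sub>j - 4\<close>, so the average of \<open>c\<close>
  over long intervals is at least \<open>4/3\<close>, which is a density of \<open>2/3\<close>. Deleting every third column
  gives a RED:IC of that density.
\<close>

abbreviation ladder :: "(nat \<times> int) ugraph" where
  "ladder \<equiv> path_graph 2 \<box> inf_path_graph"

section \<open>Neighborhoods in the ladder\<close>

lemma verts_ladder: "verts ladder = {..<2} \<times> UNIV"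
  by (simp add: cart_prod_def path_graph_def inf_path_graph_def)

lemma adj_ladder:
  "adj ladder (r, i) (s, j) \<longleftrightarrow>
     r < 2 \<and> s < 2 \<and> (r = s \<and> \<bar>j - i\<bar> = 1 \<or> i = j \<and> r \<noteq> s)"
  by (auto simp: cart_prod_def path_graph_def inf_path_graph_def)

text \<open>Truncated subtraction makes \<open>1 - r\<close> the opposite row, so one formula serves
  both rows.\<close>

lemma closed_nbhd_ladder:
  assumes "r < 2"
  shows "closed_nbhd ladder (r, i) = {(r, i - 1), (r, i), (r, i + 1), (1 - r, i)}"
  using assms
  by (auto simp: closed_nbhd_def verts_ladder adj_ladder)

text \<open>Numerical, so that the code conditions on explicit finite neighborhoods become linear
  inequalities.\<close>

definition ind :: "'a set \<Rightarrow> 'a \<Rightarrow> nat" where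
  "ind S v = of_bool (v \<in> S)"

lemma ind_le_1: "ind S v \<le> 1"
  by (simp add: ind_def)

lemma card_Int_eq_sum_ind: "finite A \<Longrightarrow> card (A \<inter> S) = (\<Sum>a\<in>A. ind S a)"
  by (simp add: ind_def)

lemma sym_diff_Int_distrib: "sym_diff (A \<inter> S) (B \<inter> S) = sym_diff A B \<inter> S"
  by blast

section \<open>Columns of a code\<close>

definition col :: "(nat \<times> int) set \<Rightarrow> int \<Rightarrow> int" where
  "col S j = int (ind S (0, j) + ind S (1, j))"

lemma col_range: "col S j \<in> {0, 1, 2}"
  by (simp add: col_def ind_def)

text \<open>Stands in for the ball around a vertex of column \<open>k\<close>: the ball of radius
  \<open>r + 1\<close> lies between the strips of radius \<open>r\<close> and
  \<open>r + 1\<close>.\<close>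

definition strip :: "int \<Rightarrow> nat \<Rightarrow> (nat \<times> int) set" where
  "strip k r = {..<2} \<times> {k - int r..k + int r}"

lemma finite_strip: "finite (strip k r)"
  by (simp add: strip_def)

lemma card_strip: "card (strip k r) = 2 * (2 * r + 1)"
  by (simp add: strip_def card_cartesian_product)

lemma card_Int_strip: "int (card (S \<inter> strip k r)) = (\<Sum>j\<in>{k - int r..k + int r}. col S j)"
proof -
  have "card (S \<inter> strip k r) = (\<Sum>a\<in>strip k r. ind S a)"
    using card_Int_eq_sum_ind[OF finite_strip] by (simp add: Int_commute)
  also have "\<dots> = (\<Sum>b\<in>{..<2}. \<Sum>j\<in>{k - int r..k + int r}. ind S (b, j))"
    by (simp add: strip_def sum.cartesian_product case_prod_beta)
  also have "int \<dots> = (\<Sum>j\<in>{k - int r..k + int r}. col S j)"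
    by (simp add: col_def sum.distrib numeral_2_eq_2)
  finally show ?thesis .
qed

lemma telescoping_sum_ge:
  fixes f g :: "int \<Rightarrow> int"
  assumes "\<And>j. g (j + 1) - g j \<le> f j"
  shows "g (m + int n) - g m \<le> (\<Sum>j\<in>{m..<m + int n}. f j)"
proof (induction n)
  case (Suc n)
  have "{m..<m + int (Suc n)} = insert (m + int n) {m..<m + int n}"
    by auto
  with Suc assms[of "m + int n"] show ?case
    by (simp add: algebra_simps)
qed simp

text \<open>The sum telescopes to at least the last value of \<open>g\<close> minus the first, hence
  to at least \<open>-4 - 0\<close>.\<close>

lemma sum_symmetric_interval_ge:
  fixes f g :: "int \<Rightarrow> int"
  assumes "\<And>j. g (j + 1) - g j \<le> f j" and "\<And>j. g j \<in> {-4..0}"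
  shows "-4 \<le> (\<Sum>j\<in>{k - int r..k + int r}. f j)"
proof -
  have "{k - int r..k + int r} = {k - int r..<k - int r + int (2 * r + 1)}"
    by auto
  then show ?thesis
    using telescoping_sum_ge[of g f "k - int r" "2 * r + 1", OF assms(1)]
      assms(2)[of "k - int r"] assms(2)[of "k - int r + int (2 * r + 1)"]
    by simp
qed

section \<open>Local constraints on a code\<close>

context
  fixes S :: "(nat \<times> int) set"
  assumes RED_IC: "RED_IC ladder S"
begin

lemma RED_IC_dominates:
  assumes "r < 2"
  shows "2 \<le> ind S (r, i - 1) + ind S (r, i) + ind S (r, i + 1)
              + ind S (1 - r, i)"
proof -
  have "2 \<le> card (closed_nbhd ladder (r, i) \<inter> S)"
    using RED_IC assms by (simp add: RED_IC_def verts_ladder)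
  moreover have "r \<noteq> 1 - r"
    by presburger
  ultimately show ?thesis
    by (simp add: closed_nbhd_ladder[OF assms] card_Int_eq_sum_ind)
qed

lemma RED_IC_separates:
  assumes "r < 2" "s < 2" "(r, i) \<noteq> (s, j)"
  shows "2 \<le> (\<Sum>a\<in>sym_diff (closed_nbhd ladder (r, i)) (closed_nbhd ladder (s, j)).
                ind S a)"
proof -
  have "2 \<le> card (sym_diff (closed_nbhd ladder (r, i) \<inter> S) (closed_nbhd ladder (s, j) \<inter> S))"
    using RED_IC assms unfolding RED_IC_def verts_ladder by blast
  moreover have "finite (sym_diff (closed_nbhd ladder (r, i)) (closed_nbhd ladder (s, j)))"
    using assms by (simp add: closed_nbhd_ladder)
  ultimately show ?thesis
    by (metis sym_diff_Int_distrib card_Int_eq_sum_ind)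
qed

text \<open>Both vertices of column \<open>i\<close> lie in both closed neighborhoods, so only the
  adjacent columns can separate them.\<close>

lemma RED_IC_separates_rung:
  "2 \<le> ind S (0, i - 1) + ind S (0, i + 1)
        + ind S (1, i - 1) + ind S (1, i + 1)"
  using RED_IC_separates[of 0 1 i i]
  by (simp add: closed_nbhd_ladder insert_Diff_if add_ac)

lemma RED_IC_separates_rail:
  assumes "r < 2"
  shows "2 \<le> ind S (r, i - 1) + ind S (1 - r, i)
              + ind S (r, i + 2) + ind S (1 - r, i + 1)"
proof -
  have "r \<noteq> 1 - r"
    by presburger
  then show ?thesis
    using RED_IC_separates[of r r i "i + 1"] assms
    by (simp add: closed_nbhd_ladder insert_Diff_if add_ac)
qed

text \<open>A vertex of an empty column can be dominated twice only by both its neighbors along the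
  row, so columns \<open>i - 1\<close> and \<open>i + 1\<close> are full. Their own rungs must then
  be separated by the far side alone.\<close>

lemma col_empty:
  assumes "col S i = 0"
  shows "col S (i - 2) = 2" "col S (i - 1) = 2" "col S (i + 1) = 2" "col S (i + 2) = 2"
proof -
  have zero: "ind S (0, i) = 0" "ind S (1, i) = 0"
    using assms by (simp_all add: col_def)
  have "ind S (b, i - 1) = 1 \<and> ind S (b, i + 1) = 1" if "b \<in> {0, 1}" for b
    using that RED_IC_dominates[of b i] zero ind_le_1[of S "(b, i - 1)"] ind_le_1[of S "(b, i + 1)"]
    by auto
  then show "col S (i - 1) = 2" "col S (i + 1) = 2"
    by (simp_all add: col_def)
  show "col S (i - 2) = 2"
    using RED_IC_separates_rung[of "i - 1"] zero ind_le_1[of S "(0, i - 2)"] ind_le_1[of S "(1, i - 2)"]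
    by (simp add: col_def)
  show "col S (i + 2) = 2"
    using RED_IC_separates_rung[of "i + 1"] zero ind_le_1[of S "(0, i + 2)"] ind_le_1[of S "(1, i + 2)"]
    by (simp add: col_def add_ac)
qed

text \<open>Dominating both middle vertices twice puts the code vertices of the outer columns in
  opposite rows. The middle code vertex then cannot be separated from its row neighbor in the column
  whose code vertex is in the same row.\<close>

lemma no_three_single_cols:
  assumes "col S (i - 1) = 1" "col S i = 1" "col S (i + 1) = 1"
  shows False
proof -
  obtain r where r: "r < 2" "ind S (r, i) = 1" "ind S (1 - r, i) = 0"
    using assms(2) that[of 0] that[of 1] ind_le_1[of S "(0, i)"]
    by (cases "ind S (0, i) = 1") (auto simp: col_def)
  have single: "ind S (r, j) + ind S (1 - r, j) = 1" if "col S j = 1" for j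
    using that r(1) by (cases "r = 0") (auto simp: col_def less_2_cases_iff)
  have "ind S (r, i - 1) + ind S (r, i + 1) \<ge> 1" "ind S (1 - r, i - 1) + ind S (1 - r, i + 1) \<ge> 1"
    using RED_IC_dominates[of r i] RED_IC_dominates[of "1 - r" i] r by auto
  moreover have "2 \<le> ind S (r, i - 2) + ind S (1 - r, i - 1) + ind S (r, i + 1) + ind S (1 - r, i)"
    using RED_IC_separates_rail[OF r(1), of "i - 1"] by (simp add: add.commute)
  moreover have "2 \<le> ind S (r, i - 1) + ind S (1 - r, i) + ind S (r, i + 2) + ind S (1 - r, i + 1)"
    using RED_IC_separates_rail[OF r(1), of i] .
  moreover note ind_le_1[of S "(r, i - 2)"] ind_le_1[of S "(r, i + 2)"]
    single[OF assms(1)] single[OF assms(3)] r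
  ultimately show False
    \<comment> \<open>The case tells which outer code vertex is in row \<open>r\<close>; the rail
      inequality towards that column retains at most one nonzero term, \<open>(r, i + 2)\<close> or
      \<open>(r, i - 2)\<close>.\<close>
    by (cases "ind S (r, i - 1) = 0") linarith+
qed

lemma col_sum_ge: "4 * (2 * int r + 1) - 4 \<le> 3 * (\<Sum>j\<in>{k - int r..k + int r}. col S j)"
proof -
  \<comment> \<open>\<open>- \<phi> j\<close> is an allowance for the deficit against the average
    4/3 (scaled by 3) on reaching column \<open>j\<close>. An empty column costs 4, repaid in halves
    by the two full columns after it; a single column costs 1, and after at most two of them a full
    column repays 2.\<close>
  define \<phi> :: "int \<Rightarrow> int" where
    "\<phi> j = (if col S j = 2 then if col S (j - 1) = 0 then -4 else -2
            else if col S j = 1 \<and> col S (j - 1) = 1 then -1 else 0)" for j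
  have "\<phi> (j + 1) - \<phi> j \<le> 3 * col S j - 4" for j
  proof -
    consider "col S j = 0" | "col S j = 1" | "col S j = 2"
      using col_range[of S j] by blast
    then show ?thesis
    proof cases
      case 1
      with col_empty[OF 1] show ?thesis
        by (simp add: \<phi>_def)
    next
      case 2
      \<comment> \<open>An empty neighbor would force column \<open>j\<close> to be full.\<close>
      have "col S (j + 1) \<noteq> 0" "col S (j - 1) \<noteq> 0"
        using 2 col_empty(2)[of "j + 1"] col_empty(3)[of "j - 1"] by auto
      with 2 no_three_single_cols[of j] col_range[of S "j - 1"] col_range[of S "j + 1"]
      show ?thesis
        by (auto simp: \<phi>_def)
    next
      case 3
      with col_empty(4)[of "j - 1"] show ?thesis
        by (auto simp: \<phi>_def add.commute)
    qed
  qed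
  then have "-4 \<le> (\<Sum>j\<in>{k - int r..k + int r}. 3 * col S j - 4)"
    by (rule sum_symmetric_interval_ge) (auto simp: \<phi>_def)
  then show ?thesis
    by (simp add: sum_subtractf sum_distrib_left)
qed

end

section \<open>Balls and densities\<close>

lemma gdist_le_iff:
  "gdist G u v \<le> enat r \<longleftrightarrow> (\<exists>n\<le>r. (u, v) \<in> {(x, y). adj G x y} ^^ n)"
proof -
  \<comment> \<open>A strict bound on an infimum yields a witness directly, without proving that the
    infimum is attained.\<close>
  have "gdist G u v \<le> enat r \<longleftrightarrow> gdist G u v < enat (Suc r)"
    by (cases "gdist G u v") auto
  then show ?thesis
    by (auto simp: gdist_def INF_less_iff less_Suc_eq_le)
qed

lemma ladder_walk_col_dist:
  "(u, v) \<in> {(x, y). adj ladder x y} ^^ n \<Longrightarrow> \<bar>snd v - snd u\<bar> \<le> int n"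
proof (induction n arbitrary: v)
  case (Suc n)
  then obtain w where w: "(u, w) \<in> {(x, y). adj ladder x y} ^^ n" "adj ladder w v"
    by auto
  from w(2) have "\<bar>snd v - snd w\<bar> \<le> 1"
    by (cases v; cases w) (auto simp: adj_ladder)
  with Suc.IH[OF w(1)] show ?case
    by simp
qed auto

lemma ladder_walk_row:
  assumes "a < 2" "\<sigma> \<in> {-1, 1}"
  shows "((a, k), (a, k + \<sigma> * int n)) \<in> {(x, y). adj ladder x y} ^^ n"
proof (induction n)
  case (Suc n)
  have "adj ladder (a, k + \<sigma> * int n) (a, k + \<sigma> * int (Suc n))"
    using assms by (auto simp: adj_ladder algebra_simps)
  with Suc show ?case
    by auto
qed simp

text \<open>Walk along the row, then cross at most one rung; the \<open>Suc\<close> pays for the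
  crossing.\<close>

lemma ladder_walk:
  assumes "a < 2" "b < 2"
  shows "\<exists>n\<le>Suc (nat \<bar>j - k\<bar>). ((a, k), (b, j)) \<in> {(x, y). adj ladder x y} ^^ n"
proof -
  let ?n = "nat \<bar>j - k\<bar>"
  have "k + (if k \<le> j then 1 else -1) * int ?n = j"
    by auto
  then have walk: "((a, k), (a, j)) \<in> {(x, y). adj ladder x y} ^^ ?n"
    using ladder_walk_row[OF assms(1), of "if k \<le> j then 1 else -1" k ?n]
    by (metis (full_types) insertI1 insertI2)
  show ?thesis
  proof (cases "a = b")
    case True
    with walk show ?thesis
      by (meson le_SucI order_refl)
  next
    case False
    then have "adj ladder (a, j) (b, j)"
      using assms by (simp add: adj_ladder)
    with walk have "((a, k), (b, j)) \<in> {(x, y). adj ladder x y} ^^ Suc ?n"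
      by auto
    then show ?thesis
      by blast
  qed
qed

lemma gball_ladder_subset_strip: "gball ladder (a, k) r \<subseteq> strip k r"
proof
  fix v assume v: "v \<in> gball ladder (a, k) r"
  then obtain n where "n \<le> r" "((a, k), v) \<in> {(x, y). adj ladder x y} ^^ n"
    by (auto simp: gball_def gdist_le_iff)
  with ladder_walk_col_dist[of "(a, k)" v n] have "\<bar>snd v - k\<bar> \<le> int r"
    by simp
  with v show "v \<in> strip k r"
    by (cases v) (auto simp: gball_def verts_ladder strip_def)
qed

lemma strip_subset_gball_ladder:
  assumes "a < 2"
  shows "strip k r \<subseteq> gball ladder (a, k) (Suc r)"
proof
  fix v assume "v \<in> strip k r"
  then obtain b j where v: "v = (b, j)" "b < 2" "nat \<bar>j - k\<bar> \<le> r"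
    by (auto simp: strip_def)
  with ladder_walk[OF assms, of b j k] show "v \<in> gball ladder (a, k) (Suc r)"
    by (auto simp: gball_def gdist_le_iff verts_ladder intro: order_trans)
qed

lemma finite_gball_ladder: "finite (gball ladder (a, k) r)"
  by (rule finite_subset[OF gball_ladder_subset_strip finite_strip])

section \<open>The lower bound on the density\<close>

lemma code_density_ge:
  assumes "RED_IC ladder S" "a < 2"
  shows "ereal (2 / 3) \<le> code_density ladder (a, k) S"
proof -
  let ?B = "gball ladder (a, k)"
  \<comment> \<open>The numerator bounds the code from below on the inner strip of radius
    \<open>r - 1\<close>; the denominator is the size of the outer strip of radius
    \<open>r\<close>.\<close>
  let ?l = "\<lambda>r. ((4 * (2 * real r - 1) - 4) / 3) / (2 * (2 * real r + 1))"
  have "?l \<longlonglongrightarrow> 2 / 3"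
    by real_asymp
  then have "limsup (\<lambda>r. ereal (?l r)) = ereal (2 / 3)"
    by (intro lim_imp_Limsup) auto
  moreover
  have "eventually (\<lambda>r. ereal (?l r) \<le> ereal (card (S \<inter> ?B r) / card (?B r))) sequentially"
  proof (rule eventually_sequentiallyI[of 1])
    fix r :: nat assume "1 \<le> r"
    then obtain q where r: "r = Suc q"
      by (cases r) auto
    have "4 * (2 * int q + 1) - 4 \<le> 3 * int (card (S \<inter> strip k q))"
      using col_sum_ge[OF assms(1)] by (simp add: card_Int_strip)
    moreover have "card (S \<inter> strip k q) \<le> card (S \<inter> ?B r)"
      unfolding r using strip_subset_gball_ladder[OF assms(2)] finite_gball_ladder
      by (intro card_mono) blast+
    ultimately have "8 * q \<le> 3 * card (S \<inter> ?B r)"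
      by presburger
    then have "real (8 * q) \<le> real (3 * card (S \<inter> ?B r))"
      by (rule of_nat_mono)
    then have num: "4 * (2 * real r - 1) - 4 \<le> 3 * real (card (S \<inter> ?B r))"
      by (simp add: r)
    have ball: "card (?B r) \<le> 2 * (2 * r + 1)" "2 * (2 * q + 1) \<le> card (?B r)"
      using card_mono[OF finite_strip gball_ladder_subset_strip, of a k r]
        card_mono[OF finite_gball_ladder strip_subset_gball_ladder[OF assms(2)], of k q]
      by (simp_all add: r card_strip)
    have "0 < card (?B r)"
      using ball(2) by presburger
    moreover have "real (card (?B r)) \<le> real (2 * (2 * r + 1))"
      using ball(1) by (rule of_nat_mono)
    ultimately have den: "0 < real (card (?B r))" "real (card (?B r)) \<le> 2 * (2 * real r + 1)"
      by (simp_all only: of_nat_0_less_iff of_nat_mult of_nat_add of_nat_numeral of_nat_1)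
    have "?l r \<le> card (S \<inter> ?B r) / card (?B r)"
    proof (rule frac_le)
      show "(4 * (2 * real r - 1) - 4) / 3 \<le> real (card (S \<inter> ?B r))"
        using num by (simp add: field_simps)
    qed (use den in simp_all)
    then show "ereal (?l r) \<le> ereal (card (S \<inter> ?B r) / card (?B r))"
      by simp
  qed
  then have "limsup (\<lambda>r. ereal (?l r)) \<le> code_density ladder (a, k) S"
    unfolding code_density_def by (rule Limsup_mono)
  ultimately show ?thesis
    by (simp only:)
qed

section \<open>The optimal code\<close>

definition opt_code :: "(nat \<times> int) set" where
  "opt_code = {..<2} \<times> {j. \<not> 3 dvd j}"

definition opt_ind :: "int \<Rightarrow> nat" where
  "opt_ind j = of_bool (\<not> 3 dvd j)"

lemma ind_opt_code: "b < 2 \<Longrightarrow> ind opt_code (b, j) = opt_ind j"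
  by (simp add: opt_code_def ind_def opt_ind_def)

text \<open>Exactly one of three consecutive integers is a multiple of 3.\<close>

lemma opt_ind_window: "opt_ind (i - 1) + opt_ind i + opt_ind (i + 1) = 2" "opt_ind i \<le> 1"
proof -
  have "3 dvd i \<and> \<not> 3 dvd (i - 1) \<and> \<not> 3 dvd (i + 1) \<or>
    \<not> 3 dvd i \<and> 3 dvd (i - 1) \<and> \<not> 3 dvd (i + 1) \<or>
    \<not> 3 dvd i \<and> \<not> 3 dvd (i - 1) \<and> 3 dvd (i + 1)"
    by presburger
  then show "opt_ind (i - 1) + opt_ind i + opt_ind (i + 1) = 2"
    by (auto simp: opt_ind_def)
  show "opt_ind i \<le> 1"
    by (simp add: opt_ind_def)
qed

lemma opt_code_dominates:
  assumes "r < 2"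
  shows "2 \<le> card (closed_nbhd ladder (r, i) \<inter> opt_code)"
proof -
  have "r \<noteq> 1 - r" "1 - r < 2"
    by presburger+
  then show ?thesis
    using opt_ind_window[of i] assms
    by (simp add: closed_nbhd_ladder card_Int_eq_sum_ind ind_opt_code)
qed

text \<open>Ordering the columns halves the cases; symmetry restores the rest. Disjoint
  neighborhoods are separated by domination alone, and overlapping ones belong to vertices at
  distance at most 2.\<close>

lemma opt_code_separates_le:
  assumes "r < 2" "s < 2" "(r, i) \<noteq> (s, j)" "i \<le> j"
  shows "2 \<le> card (sym_diff (closed_nbhd ladder (r, i)) (closed_nbhd ladder (s, j)) \<inter> opt_code)"
    (is "_ \<le> card (?D \<inter> _)")
proof -
  have fin: "finite (?D \<inter> opt_code)"
    using assms by (simp add: closed_nbhd_ladder)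
  have sum: "card (?D \<inter> opt_code) = (\<Sum>a\<in>?D. ind opt_code a)"
    using assms by (intro card_Int_eq_sum_ind) (simp add: closed_nbhd_ladder)
  have rows: "r \<noteq> 1 - r" "1 - r < 2"
    by presburger+
  consider "closed_nbhd ladder (r, i) \<inter> closed_nbhd ladder (s, j) = {}"
    | "j = i" "s = 1 - r" | "j = i + 1" "s = r" | "j = i + 1" "s = 1 - r" | "j = i + 2" "s = r"
    using assms by (fastforce simp: closed_nbhd_ladder)
  then show ?thesis
  proof cases
    case 1
    then have "closed_nbhd ladder (r, i) \<inter> opt_code \<subseteq> ?D \<inter> opt_code"
      by blast
    then show ?thesis
      using card_mono[OF fin] opt_code_dominates[OF assms(1)] order_trans by blast
  next
    case 2
    then show ?thesis
      using opt_ind_window[of i] rows assms unfolding sum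
      by (simp add: closed_nbhd_ladder insert_Diff_if ind_opt_code)
  next
    case 3
    then show ?thesis
      using opt_ind_window[of i] opt_ind_window[of "i + 1"] rows assms unfolding sum
      by (simp add: closed_nbhd_ladder insert_Diff_if ind_opt_code)
  next
    case 4
    then show ?thesis
      using opt_ind_window[of i] opt_ind_window[of "i + 1"] rows assms unfolding sum
      by (simp add: closed_nbhd_ladder insert_Diff_if ind_opt_code)
  next
    case 5
    \<comment> \<open>Columns \<open>i - 1\<close> and \<open>i\<close> contribute at least 1 in row
      \<open>r\<close>, and so do column \<open>i\<close> in the other row and column
      \<open>i + 2\<close>.\<close>
    then show ?thesis
      using opt_ind_window[of i] opt_ind_window[of "i + 1"] rows assms unfolding sum
      by (simp add: closed_nbhd_ladder insert_Diff_if ind_opt_code add.commute)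
  qed
qed

lemma RED_IC_opt_code: "RED_IC ladder opt_code"
  unfolding RED_IC_def sym_diff_Int_distrib
proof (intro conjI ballI impI)
  show "opt_code \<subseteq> verts ladder"
    by (auto simp: opt_code_def verts_ladder)
next
  fix v assume "v \<in> verts ladder"
  then show "2 \<le> card (closed_nbhd ladder v \<inter> opt_code)"
    by (cases v) (simp add: verts_ladder opt_code_dominates)
next
  fix u v assume "u \<in> verts ladder" "v \<in> verts ladder" "u \<noteq> v"
  then show "2 \<le> card (sym_diff (closed_nbhd ladder u) (closed_nbhd ladder v) \<inter> opt_code)"
    using opt_code_separates_le[of "fst u" "fst v" "snd u" "snd v"]
      opt_code_separates_le[of "fst v" "fst u" "snd v" "snd u"]
    by (cases "snd u \<le> snd v") (auto simp: verts_ladder Un_commute)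
qed

lemma card_opt_code_Int_strip_le:
  "3 * int (card (opt_code \<inter> strip k r)) \<le> 4 * (2 * int r + 1) + 4"
proof -
  \<comment> \<open>A 3-periodic function whose increments equal
    \<open>4 - 3 * col opt_code j\<close>: 4 at a deleted column and -2 at each full one.\<close>
  define g :: "int \<Rightarrow> int" where
    "g j = (if j mod 3 = 0 then -4 else if j mod 3 = 1 then 0 else -2)" for j
  have "g (j + 1) - g j \<le> 4 - 3 * col opt_code j" for j
  proof -
    have "j mod 3 = 0 \<and> (j + 1) mod 3 = 1 \<or> j mod 3 = 1 \<and> (j + 1) mod 3 = 2
        \<or> j mod 3 = 2 \<and> (j + 1) mod 3 = 0"
      by presburger
    then show ?thesis
      by (auto simp: g_def col_def ind_opt_code opt_ind_def dvd_eq_mod_eq_0)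
  qed
  then have "-4 \<le> (\<Sum>j\<in>{k - int r..k + int r}. 4 - 3 * col opt_code j)"
    by (rule sum_symmetric_interval_ge) (auto simp: g_def)
  then show ?thesis
    by (simp add: card_Int_strip sum_subtractf sum_distrib_left)
qed

lemma code_density_opt_code_le:
  assumes "a < 2"
  shows "code_density ladder (a, k) opt_code \<le> ereal (2 / 3)"
proof -
  let ?B = "gball ladder (a, k)"
  \<comment> \<open>Here the strips swap roles: the outer one bounds the code from above, the inner
    one the ball from below, with a positive size once \<open>r\<close> is at least 1.\<close>
  let ?u = "\<lambda>r. ((4 * (2 * real r + 1) + 4) / 3) / (2 * (2 * real r - 1))"
  have "?u \<longlonglongrightarrow> 2 / 3"
    by real_asymp
  then have "limsup (\<lambda>r. ereal (?u r)) = ereal (2 / 3)"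
    by (intro lim_imp_Limsup) auto
  moreover
  have "eventually (\<lambda>r. ereal (card (opt_code \<inter> ?B r) / card (?B r)) \<le> ereal (?u r)) sequentially"
  proof (rule eventually_sequentiallyI[of 1])
    fix r :: nat assume "1 \<le> r"
    then obtain q where r: "r = Suc q"
      by (cases r) auto
    have "card (opt_code \<inter> ?B r) \<le> card (opt_code \<inter> strip k r)"
      using gball_ladder_subset_strip finite_strip by (intro card_mono) blast+
    with card_opt_code_Int_strip_le[of k r]
    have "3 * card (opt_code \<inter> ?B r) \<le> 8 * r + 8"
      by presburger
    then have "real (3 * card (opt_code \<inter> ?B r)) \<le> real (8 * r + 8)"
      by (rule of_nat_mono)
    then have num: "3 * real (card (opt_code \<inter> ?B r)) \<le> 4 * (2 * real r + 1) + 4"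
      by simp
    have "2 * (2 * q + 1) \<le> card (?B r)"
      using card_mono[OF finite_gball_ladder strip_subset_gball_ladder[OF assms], of k q]
      by (simp add: r card_strip)
    then have "real (2 * (2 * q + 1)) \<le> real (card (?B r))"
      by (rule of_nat_mono)
    then have den: "2 * (2 * real r - 1) \<le> real (card (?B r))"
      by (simp add: r)
    have "card (opt_code \<inter> ?B r) / card (?B r) \<le> ?u r"
    proof (rule frac_le)
      show "real (card (opt_code \<inter> ?B r)) \<le> (4 * (2 * real r + 1) + 4) / 3"
        using num by (simp add: field_simps)
      show "0 < 2 * (2 * real r - 1)"
        by (simp add: r)
    qed (use den in simp_all)
    then show "ereal (card (opt_code \<inter> ?B r) / card (?B r)) \<le> ereal (?u r)"
      by simp
  qed
  then have "code_density ladder (a, k) opt_code \<le> limsup (\<lambda>r. ereal (?u r))"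
    unfolding code_density_def by (rule Limsup_mono)
  ultimately show ?thesis
    by (simp only:)
qed

theorem theorem8:
  fixes v0 :: "nat \<times> int"
  assumes "v0 \<in> verts (path_graph 2 \<box> inf_path_graph)"
  shows "RED_IC_density (path_graph 2 \<box> inf_path_graph) v0 = ereal (2 / 3) \<and>
    (\<exists>S. RED_IC (path_graph 2 \<box> inf_path_graph) S \<and>
         code_density (path_graph 2 \<box> inf_path_graph) v0 S = ereal (2 / 3))"
proof -
  obtain a k where v0: "v0 = (a, k)" "a < 2"
    using assms by (auto simp: verts_ladder)
  \<comment> \<open>The general lower bound applies to \<open>opt_code\<close> as well, so its
    density is exactly 2/3 and the infimum is attained.\<close>
  have opt: "code_density ladder v0 opt_code = ereal (2 / 3)"
    unfolding v0(1)
    using code_density_opt_code_le[OF v0(2)] code_density_ge[OF RED_IC_opt_code v0(2)]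
    by (rule antisym)
  have "RED_IC_density ladder v0 = ereal (2 / 3)"
    unfolding RED_IC_density_def
  proof (rule antisym)
    show "(INF S\<in>{S. RED_IC ladder S}. code_density ladder v0 S) \<le> ereal (2 / 3)"
      using RED_IC_opt_code opt by (metis INF_lower mem_Collect_eq)
    show "ereal (2 / 3) \<le> (INF S\<in>{S. RED_IC ladder S}. code_density ladder v0 S)"
      using code_density_ge v0 by (auto intro: INF_greatest)
  qed
  with RED_IC_opt_code opt show ?thesis
    by blast
qed

end
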